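(* $$\tilde{\mathfrak{S}}(213,231)^{\mathsf{des},\mathsf{iar},\mathsf{comp}}(t,r,p)=\frac{1-z}{(1-rpz)(1-z-tz)}.$$
   Context: $\mathfrak{S}_n$ is the set of permutations $\pi=\pi(1)\cdots\pi(n)$ of $[n]=\{1,\dots,n\}$. A permutation $\pi\in\mathfrak{S}_n$ contains the pattern $\sigma\in\mathfrak{S}_k$ if there are $j_1<\cdots<j_k$ such that $\pi(j_a)<\pi(j_b)$ if and only if $\sigma(a)<\sigma(b)$ for all $1\le a<b\le k$; otherwise it avoids $\sigma$. For a set $P$ of patterns, $\mathfrak{S}_n(P)$ is the set of $\pi\in\mathfrak{S}_n$ avoiding every pattern in $P$. For $\pi\in\mathfrak{S}_n$: $\mathrm{DES}(\pi)=\{i\in[n-1]:\pi(i)>\pi(i+1)\}$, $\mathsf{des}(\pi)=|\mathrm{DES}(\pi)|$, $\mathsf{iar}(\pi)=\min(\mathrm{DES}(\pi)\cup\{n\})$, $\mathsf{comp}(\pi)=|\{i\in[n]:\pi(j)\le i\text{ for all }j\le i\}|$. Define the formal power series in $z$ $$\mathfrak{S}(P)^{\mathsf{des},\mathsf{iar},\mathsf{comp}}(t,r,p;z)=\sum_{n\ge0}z^n\sum_{\pi\in\mathfrak{S}_n(P)}t^{\mathsf{des}(\pi)}r^{\mathsf{iar}(\pi)}p^{\mathsf{comp}(\pi)},$$ where the empty permutation ($n=0$) contributes $1$, and $\tilde{\mathfrak{S}}(P)^{\mathsf{des},\mathsf{iar},\mathsf{comp}}(t,r,p)=\big(\mathfrak{S}(P)^{\mathsf{des},\mathsf{iar},\mathsf{comp}}(t,r,p;z)-1\big)/(rpz)$.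 *)

theory Defs
  imports
    "HOL-Combinatorics.Multiset_Permutations"
    "HOL-Computational_Algebra.Formal_Power_Series"
begin

text \<open>Permutations and patterns are given in one-line notation, as lists; positions count from 1.\<close>

definition entry :: "nat list \<Rightarrow> nat \<Rightarrow> nat" where
  "entry \<pi> i = \<pi> ! (i - 1)"

definition contains_pattern :: "nat list \<Rightarrow> nat list \<Rightarrow> bool" where
  "contains_pattern \<pi> \<sigma> \<longleftrightarrow>
     (\<exists>j :: nat \<Rightarrow> nat.
        strict_mono_on {1..length \<sigma>} j \<and>
        j ` {1..length \<sigma>} \<subseteq> {1..length \<pi>} \<and>
        (\<forall>a b. 1 \<le> a \<and> a < b \<and> b \<le> length \<sigma> \<longrightarrow>
           (entry \<pi> (j a) < entry \<pi> (j b) \<longleftrightarrow> entry \<sigma> a < entry \<sigma> b)))"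

definition avoiders :: "nat \<Rightarrow> nat list set \<Rightarrow> nat list set" where
  "avoiders n P =
     {\<pi> \<in> permutations_of_set {1..n}. \<forall>\<sigma>\<in>P. \<not> contains_pattern \<pi> \<sigma>}"

definition DES :: "nat list \<Rightarrow> nat set" where
  "DES \<pi> = {i \<in> {1..<length \<pi>}. entry \<pi> i > entry \<pi> (i + 1)}"

definition des :: "nat list \<Rightarrow> nat" where
  "des \<pi> = card (DES \<pi>)"

definition iar :: "nat list \<Rightarrow> nat" where
  "iar \<pi> = Min (DES \<pi> \<union> {length \<pi>})"

definition num_comp :: "nat list \<Rightarrow> nat" where
  "num_comp \<pi> = card {i \<in> {1..length \<pi>}. \<forall>j\<in>{1..i}. entry \<pi> j \<le> i}"

text \<open>
  The variable \<open>z\<close> is \<^const>\<open>fps_X\<close>. The weights \<open>t\<close>, \<open>r\<close>, \<open>p\<close> are arbitrary ring elements;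
  the series with formal weights is the instance where they are the indeterminates of a
  polynomial ring or of its field of fractions.
\<close>

definition avoid_gf :: "nat list set \<Rightarrow> 'a \<Rightarrow> 'a \<Rightarrow> 'a \<Rightarrow> 'a :: comm_ring_1 fps" where
  "avoid_gf P t r p =
     Abs_fps (\<lambda>n. \<Sum>\<pi>\<in>avoiders n P. t ^ des \<pi> * r ^ iar \<pi> * p ^ num_comp \<pi>)"

text \<open>
  Division of power series over a field cancels the common power of \<open>z\<close>, so for nonzero
  \<open>r\<close>, \<open>p\<close> this is the genuine quotient; the constant term of the numerator vanishes
  when \<open>[] \<notin> P\<close>.
\<close>

definition avoid_gf_tilde :: "nat list set \<Rightarrow> 'a \<Rightarrow> 'a \<Rightarrow> 'a \<Rightarrow> 'a :: field fps" where
  "avoid_gf_tilde P t r p =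
     (avoid_gf P t r p - 1) / (fps_const r * fps_const p * fps_X)"

end

theory Submission
  imports Defs
begin

text \<open>
  A permutation avoids both 213 and 231 exactly when no entry has a smaller and a larger entry
  to its right, that is, when each entry is the minimum or the maximum of the suffix that starts
  with it (\<open>avoids_213_231_iff_suffix_extremal\<close>). So for \<open>n \<ge> 1\<close> an avoider of size \<open>n + 1\<close>
  arises in exactly one way from an avoider \<open>\<pi>\<close> of size \<open>n\<close>, by putting a new minimum or a new maximum in front
  (\<open>suffix_extremal_perms_Suc\<close>; for \<open>n = 0\<close> the two constructions coincide).

  For \<open>n \<ge> 1\<close> a new minimum creates no descent and adds one to both the initial ascending run and the number
  of components. A new maximum creates one descent, at position 1, and resets the other two
  statistics to 1. Hence the weighted sums \<open>A n\<close> over the avoiders of size \<open>n\<close> satisfy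
  \<open>A 1 = r p\<close> and \<open>A (n + 2) = r p A (n + 1) + t r p B (n + 1)\<close>, where \<open>B\<close> is the sum of
  \<open>t ^ des \<pi>\<close> alone. The same construction gives \<open>B (n + 1) = (1 + t) ^ n\<close>. In terms of
  generating functions, \<open>(A - 1) (1 - r p z) = r p z (1 + t z / (1 - (1 + t) z))\<close>, and the
  bracket equals \<open>(1 - z) / (1 - z - t z)\<close>.
\<close>

section \<open>The structure of the avoiders\<close>

fun suffix_extremal :: "nat list \<Rightarrow> bool" where
  "suffix_extremal [] \<longleftrightarrow> True"
| "suffix_extremal (x # xs) \<longleftrightarrow>
     ((\<forall>y\<in>set xs. x < y) \<or> (\<forall>y\<in>set xs. y < x)) \<and> suffix_extremal xs"

lemma suffix_extremal_map_Suc [simp]: "suffix_extremal (map Suc xs) = suffix_extremal xs"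
  by (induction xs) auto

lemma suffix_extremal_iff_nth:
  assumes "distinct xs"
  shows "suffix_extremal xs \<longleftrightarrow>
    \<not> (\<exists>i j k. i < j \<and> i < k \<and> j < length xs \<and> k < length xs \<and> xs ! j < xs ! i \<and> xs ! i < xs ! k)"
  using assms
proof (induction xs)
  case Nil
  then show ?case by simp
next
  case (Cons x xs)
  let ?bad = "\<lambda>xs :: nat list. \<exists>i j k. i < j \<and> i < k \<and> j < length xs \<and> k < length xs
    \<and> xs ! j < xs ! i \<and> xs ! i < xs ! k"
  (* An offending triple either has x as its pivot or lies entirely in xs. *)
  have "?bad (x # xs) \<longleftrightarrow> (\<exists>y\<in>set xs. \<exists>z\<in>set xs. y < x \<and> x < z) \<or> ?bad xs"
  proof
    assume "?bad (x # xs)"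
    then obtain i j k where ijk: "i < j" "i < k" "j < length (x # xs)" "k < length (x # xs)"
      "(x # xs) ! j < (x # xs) ! i" "(x # xs) ! i < (x # xs) ! k"
      by blast
    then obtain j' k' where jk: "j = Suc j'" "k = Suc k'"
      by (cases j; cases k) auto
    show "(\<exists>y\<in>set xs. \<exists>z\<in>set xs. y < x \<and> x < z) \<or> ?bad xs"
    proof (cases i)
      case 0
      with ijk jk have "xs ! j' \<in> set xs" "xs ! k' \<in> set xs" "xs ! j' < x" "x < xs ! k'"
        by auto
      then show ?thesis by blast
    next
      case (Suc i')
      with ijk jk have "?bad xs"
        by (intro exI[of _ i'] exI[of _ j'] exI[of _ k']) auto
      then show ?thesis by blast
    qed
  next
    assume "(\<exists>y\<in>set xs. \<exists>z\<in>set xs. y < x \<and> x < z) \<or> ?bad xs"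
    then show "?bad (x # xs)"
    proof
      assume "\<exists>y\<in>set xs. \<exists>z\<in>set xs. y < x \<and> x < z"
      then obtain j k where "j < length xs" "k < length xs" "xs ! j < x" "x < xs ! k"
        by (metis in_set_conv_nth)
      then show ?thesis
        by (intro exI[of _ 0] exI[of _ "Suc j"] exI[of _ "Suc k"]) auto
    next
      assume "?bad xs"
      then obtain i j k where "i < j" "i < k" "j < length xs" "k < length xs"
        "xs ! j < xs ! i" "xs ! i < xs ! k"
        by blast
      then show ?thesis
        by (intro exI[of _ "Suc i"] exI[of _ "Suc j"] exI[of _ "Suc k"]) auto
    qed
  qed
  moreover have "(\<forall>y\<in>set xs. x < y) \<or> (\<forall>y\<in>set xs. y < x) \<longleftrightarrow>
      \<not> (\<exists>y\<in>set xs. \<exists>z\<in>set xs. y < x \<and> x < z)"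
    using Cons.prems by (auto; metis linorder_neqE_nat)
  ultimately show ?case
    using Cons by simp
qed

lemma contains_pattern_3:
  "contains_pattern \<pi> [a, b, c] \<longleftrightarrow>
     (\<exists>i j k. i < j \<and> j < k \<and> k < length \<pi> \<and> (\<pi> ! i < \<pi> ! j \<longleftrightarrow> a < b) \<and>
        (\<pi> ! i < \<pi> ! k \<longleftrightarrow> a < c) \<and> (\<pi> ! j < \<pi> ! k \<longleftrightarrow> b < c))"
proof
  assume "contains_pattern \<pi> [a, b, c]"
  then obtain f where mono: "strict_mono_on {1..3} f"
    and range: "f ` {1..3} \<subseteq> {1..length \<pi>}"
    and order: "\<And>u v. 1 \<le> u \<Longrightarrow> u < v \<Longrightarrow> v \<le> 3 \<Longrightarrow>
      entry \<pi> (f u) < entry \<pi> (f v) \<longleftrightarrow> entry [a, b, c] u < entry [a, b, c] v"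
    unfolding contains_pattern_def by (auto simp: eval_nat_numeral)
  have "f 1 < f 2" "f 2 < f 3"
    using mono by (auto simp: strict_mono_on_def)
  moreover have "1 \<le> f 1" "f 3 \<le> length \<pi>"
    using range by (auto simp: image_subset_iff)
  ultimately show "\<exists>i j k. i < j \<and> j < k \<and> k < length \<pi> \<and> (\<pi> ! i < \<pi> ! j \<longleftrightarrow> a < b) \<and>
        (\<pi> ! i < \<pi> ! k \<longleftrightarrow> a < c) \<and> (\<pi> ! j < \<pi> ! k \<longleftrightarrow> b < c)"
    using order[of 1 2] order[of 1 3] order[of 2 3]
    by (intro exI[of _ "f 1 - 1"] exI[of _ "f 2 - 1"] exI[of _ "f 3 - 1"])
      (auto simp: entry_def)
next
  assume "\<exists>i j k. i < j \<and> j < k \<and> k < length \<pi> \<and> (\<pi> ! i < \<pi> ! j \<longleftrightarrow> a < b) \<and>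
        (\<pi> ! i < \<pi> ! k \<longleftrightarrow> a < c) \<and> (\<pi> ! j < \<pi> ! k \<longleftrightarrow> b < c)"
  then obtain i j k where ijk: "i < j" "j < k" "k < length \<pi>" "\<pi> ! i < \<pi> ! j \<longleftrightarrow> a < b"
    "\<pi> ! i < \<pi> ! k \<longleftrightarrow> a < c" "\<pi> ! j < \<pi> ! k \<longleftrightarrow> b < c"
    by blast
  define f where "f = (\<lambda>u :: nat. if u = 1 then Suc i else if u = 2 then Suc j else Suc k)"
  have "strict_mono_on {1..3} f"
    using ijk by (auto simp: strict_mono_on_def f_def)
  moreover have "f ` {1..3} \<subseteq> {1..length \<pi>}"
    using ijk by (auto simp: f_def)
  moreover have "entry \<pi> (f u) < entry \<pi> (f v) \<longleftrightarrow> entry [a, b, c] u < entry [a, b, c] v"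
    if "1 \<le> u \<and> u < v \<and> v \<le> 3" for u v
  proof -
    have "u = 1 \<and> v = 2 \<or> u = 1 \<and> v = 3 \<or> u = 2 \<and> v = 3"
      using that by arith
    then show ?thesis
      using ijk by (auto simp: f_def entry_def)
  qed
  ultimately show "contains_pattern \<pi> [a, b, c]"
    unfolding contains_pattern_def by (intro exI[of _ f]) (simp add: eval_nat_numeral)
qed

text \<open>
  The letter 2 of either pattern marks an entry with a smaller and a larger entry to its right;
  the two patterns cover the two orders in which these can appear.
\<close>

lemma avoids_213_231_iff_suffix_extremal:
  assumes "distinct \<pi>"
  shows "\<not> contains_pattern \<pi> [2, 1, 3] \<and> \<not> contains_pattern \<pi> [2, 3, 1]
    \<longleftrightarrow> suffix_extremal \<pi>"
proof -
  have ne: "\<pi> ! i \<noteq> \<pi> ! j" if "i < j" "j < length \<pi>" for i j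
    using assms that by (simp add: nth_eq_iff_index_eq)
  have "contains_pattern \<pi> [2, 1, 3] \<or> contains_pattern \<pi> [2, 3, 1] \<longleftrightarrow>
    (\<exists>i j k. i < j \<and> i < k \<and> j < length \<pi> \<and> k < length \<pi> \<and> \<pi> ! j < \<pi> ! i \<and> \<pi> ! i < \<pi> ! k)"
    (is "?L \<longleftrightarrow> ?R")
  proof
    assume ?L
    then consider i j k where "i < j" "j < k" "k < length \<pi>" "\<not> \<pi> ! i < \<pi> ! j" "\<pi> ! i < \<pi> ! k"
      | i j k where "i < j" "j < k" "k < length \<pi>" "\<pi> ! i < \<pi> ! j" "\<not> \<pi> ! i < \<pi> ! k"
      by (auto simp: contains_pattern_3)
    then show ?R
    proof cases
      case (1 i j k)
      then show ?thesis
        using ne[of i j] by (intro exI[of _ i] exI[of _ j] exI[of _ k]) auto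
    next
      case (2 i j k)
      then show ?thesis
        using ne[of i k] by (intro exI[of _ i] exI[of _ k] exI[of _ j]) auto
    qed
  next
    assume ?R
    then obtain i j k where ijk: "i < j" "i < k" "j < length \<pi>" "k < length \<pi>"
      "\<pi> ! j < \<pi> ! i" "\<pi> ! i < \<pi> ! k"
      by blast
    then have "j \<noteq> k" by auto
    then consider "j < k" | "k < j" by linarith
    then show ?L
    proof cases
      case 1
      then have "contains_pattern \<pi> [2, 1, 3]"
        unfolding contains_pattern_3 using ijk
        by (intro exI[of _ i] exI[of _ j] exI[of _ k]) auto
      then show ?thesis ..
    next
      case 2
      then have "contains_pattern \<pi> [2, 3, 1]"
        unfolding contains_pattern_3 using ijk
        by (intro exI[of _ i] exI[of _ k] exI[of _ j]) auto
      then show ?thesis ..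
    qed
  qed
  then show ?thesis
    using suffix_extremal_iff_nth[OF assms] by blast
qed

definition suffix_extremal_perms :: "nat \<Rightarrow> nat list set" where
  "suffix_extremal_perms n = {\<pi>. set \<pi> = {1..n} \<and> distinct \<pi> \<and> suffix_extremal \<pi>}"

lemma avoiders_213_231_eq: "avoiders n {[2, 1, 3], [2, 3, 1]} = suffix_extremal_perms n"
  unfolding avoiders_def permutations_of_set_def suffix_extremal_perms_def
  using avoids_213_231_iff_suffix_extremal by blast

lemma length_suffix_extremal_perm:
  assumes "\<pi> \<in> suffix_extremal_perms n"
  shows "length \<pi> = n"
  using assms by (auto simp: suffix_extremal_perms_def dest: distinct_card)

lemma set_suffix_extremal_perm:
  assumes "\<pi> \<in> suffix_extremal_perms n"
  shows "set \<pi> = {1..n}"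
  using assms by (simp add: suffix_extremal_perms_def)

lemma finite_suffix_extremal_perms: "finite (suffix_extremal_perms n)"
  by (rule finite_subset[OF _ finite_permutations_of_set[of "{1..n}"]])
    (auto simp only: suffix_extremal_perms_def permutations_of_set_def)

lemma suffix_extremal_perms_0: "suffix_extremal_perms 0 = {[]}"
  by (auto simp: suffix_extremal_perms_def)

lemma suffix_extremal_perms_Suc:
  "suffix_extremal_perms (Suc n) =
     (\<lambda>\<pi>. 1 # map Suc \<pi>) ` suffix_extremal_perms n \<union>
     (\<lambda>\<pi>. Suc n # \<pi>) ` suffix_extremal_perms n"
  (is "_ = ?f ` ?A \<union> ?g ` ?A")
proof (intro equalityI subsetI)
  fix \<rho> assume "\<rho> \<in> suffix_extremal_perms (Suc n)"
  then have \<rho>: "set \<rho> = {1..Suc n}" "distinct \<rho>" "suffix_extremal \<rho>"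
    by (auto simp: suffix_extremal_perms_def)
  then obtain x xs where xs: "\<rho> = x # xs"
    by (cases \<rho>) auto
  have set_xs: "set xs = {1..Suc n} - {x}"
    using \<rho> xs by auto
  have x: "1 \<le> x" "x \<le> Suc n"
    using \<rho> xs by auto
  consider "\<forall>y\<in>set xs. x < y" | "\<forall>y\<in>set xs. y < x"
    using \<rho> xs by auto
  then show "\<rho> \<in> ?f ` ?A \<union> ?g ` ?A"
  proof cases
    case 1
    have "x = 1"
    proof (rule ccontr)
      assume "x \<noteq> 1"
      then have "1 \<in> set xs" by (auto simp: set_xs)
      with 1 x show False by auto
    qed
    define ys where "ys = map (\<lambda>y. y - 1) xs"
    have "map Suc ys = map id xs"
      unfolding ys_def map_map using set_xs by (intro map_cong) auto
    then have ys: "xs = map Suc ys" by simp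
    have "Suc ` set ys = Suc ` {1..n}"
      using set_xs ys \<open>x = 1\<close> by (auto simp: image_Suc_atLeastAtMost)
    then have "set ys = {1..n}"
      by (simp only: inj_image_eq_iff[OF inj_Suc])
    moreover have "distinct ys" "suffix_extremal ys"
      using \<rho> xs ys by (auto simp: distinct_map)
    ultimately have "ys \<in> ?A"
      by (simp add: suffix_extremal_perms_def)
    then show ?thesis
      using xs ys \<open>x = 1\<close> by blast
  next
    case 2
    have "x = Suc n"
    proof (rule ccontr)
      assume "x \<noteq> Suc n"
      then have "Suc n \<in> set xs" by (auto simp: set_xs)
      with 2 x show False by auto
    qed
    then have "set xs = {1..n}"
      unfolding set_xs by auto
    then have "xs \<in> ?A"
      using \<rho> xs by (simp add: suffix_extremal_perms_def)
    then show ?thesis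
      using xs \<open>x = Suc n\<close> by blast
  qed
next
  fix \<rho> assume "\<rho> \<in> ?f ` ?A \<union> ?g ` ?A"
  then consider \<pi> where "\<pi> \<in> ?A" "\<rho> = ?f \<pi>" | \<pi> where "\<pi> \<in> ?A" "\<rho> = ?g \<pi>"
    by blast
  then show "\<rho> \<in> suffix_extremal_perms (Suc n)"
  proof cases
    case 1
    moreover have "insert 1 (Suc ` {1..n}) = {1..Suc n}"
      by (auto simp: image_Suc_atLeastAtMost)
    ultimately show ?thesis
      by (auto simp: suffix_extremal_perms_def distinct_map)
  next
    case 2
    then show ?thesis
      by (auto simp: suffix_extremal_perms_def)
  qed
qed

text \<open>
  From size 2 on the two constructions have disjoint images: their results begin with different
  entries, 1 and the size.
\<close>

lemma sum_suffix_extremal_perms_Suc_Suc: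
  fixes f :: "nat list \<Rightarrow> 'a :: comm_monoid_add"
  shows "(\<Sum>\<pi>\<in>suffix_extremal_perms (Suc (Suc n)). f \<pi>) =
    (\<Sum>\<pi>\<in>suffix_extremal_perms (Suc n). f (1 # map Suc \<pi>)) +
    (\<Sum>\<pi>\<in>suffix_extremal_perms (Suc n). f (Suc (Suc n) # \<pi>))"
  unfolding suffix_extremal_perms_Suc[of "Suc n"]
  by (subst sum.union_disjoint) (auto simp: finite_suffix_extremal_perms sum.reindex inj_on_def)

section \<open>The effect of a new first entry on the statistics\<close>

lemma entry_Cons_1: "entry (x # xs) (Suc 0) = x"
  by (simp add: entry_def)

lemma entry_Cons_Suc: "1 \<le> i \<Longrightarrow> entry (x # xs) (Suc i) = entry xs i"
  by (simp add: entry_def nth_Cons')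

lemma entry_in_set: "1 \<le> i \<Longrightarrow> i \<le> length xs \<Longrightarrow> entry xs i \<in> set xs"
  by (simp add: entry_def)

lemma entry_map: "1 \<le> i \<Longrightarrow> i \<le> length xs \<Longrightarrow> entry (map f xs) i = f (entry xs i)"
  by (simp add: entry_def)

lemma DES_map_Suc: "DES (map Suc xs) = DES xs"
  by (auto simp: DES_def entry_map)

lemma DES_Cons:
  assumes "xs \<noteq> []"
  shows "DES (x # xs) = (if x > hd xs then {1} else {}) \<union> Suc ` DES xs"
proof (rule set_eqI)
  fix i
  have hd: "entry xs (Suc 0) = hd xs"
    using assms by (simp add: entry_def hd_conv_nth)
  consider "i = 0" | "i = 1" | k where "i = Suc k" "1 \<le> k"
    by (metis One_nat_def Suc_le_eq gr0_conv_Suc not_gr0)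
  then show "i \<in> DES (x # xs) \<longleftrightarrow> i \<in> (if x > hd xs then {1} else {}) \<union> Suc ` DES xs"
  proof cases
    case 1
    then show ?thesis by (auto simp: DES_def)
  next
    case 2
    then show ?thesis
      using assms hd by (auto simp: DES_def entry_Cons_1 entry_Cons_Suc)
  next
    case (3 k)
    then show ?thesis
      by (auto simp: DES_def entry_Cons_Suc)
  qed
qed

lemma finite_DES: "finite (DES xs)"
  by (simp add: DES_def)

lemma des_Cons_less:
  assumes "xs \<noteq> []" and "x < hd xs"
  shows "des (x # xs) = des xs"
  using assms by (simp add: des_def DES_Cons card_image)

lemma des_Cons_greater:
  assumes "xs \<noteq> []" and "x > hd xs"
  shows "des (x # xs) = Suc (des xs)"
proof -
  have "1 \<notin> Suc ` DES xs"
    by (auto simp: DES_def)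
  then show ?thesis
    using assms by (simp add: des_def DES_Cons card_image finite_DES)
qed

lemma iar_Cons_less:
  assumes "xs \<noteq> []" and "x < hd xs"
  shows "iar (x # xs) = Suc (iar xs)"
proof -
  have "DES (x # xs) \<union> {length (x # xs)} = Suc ` (DES xs \<union> {length xs})"
    using assms by (simp add: DES_Cons)
  then show ?thesis
    unfolding iar_def using mono_Min_commute[OF mono_Suc, of "DES xs \<union> {length xs}"]
    by (simp only:) (simp add: finite_DES)
qed

lemma iar_Cons_greater:
  assumes "xs \<noteq> []" and "x > hd xs"
  shows "iar (x # xs) = 1"
  unfolding iar_def using assms
  by (intro Min_eqI) (auto simp: DES_Cons finite_DES)

text \<open>
  The new first entry is a component by itself, and every later component boundary moves one
  position to the right, because positions and values are shifted by the same amount.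
\<close>

lemma num_comp_Cons_min: "num_comp (1 # map Suc \<pi>) = Suc (num_comp \<pi>)"
proof -
  let ?C = "\<lambda>\<pi>. {i \<in> {1..length \<pi>}. \<forall>j\<in>{1..i}. entry \<pi> j \<le> i}"
  have "i \<in> ?C (1 # map Suc \<pi>) \<longleftrightarrow> i \<in> insert 1 (Suc ` ?C \<pi>)" for i
  proof -
    consider "i = 0" | "i = 1" | k where "i = Suc k" "1 \<le> k"
      by (metis One_nat_def Suc_le_eq gr0_conv_Suc not_gr0)
    then show ?thesis
    proof cases
      case 1
      then show ?thesis by auto
    next
      case 2
      then show ?thesis by (auto simp: entry_def)
    next
      case (3 k)
      have "(\<forall>j\<in>{1..Suc k}. entry (1 # map Suc \<pi>) j \<le> Suc k) \<longleftrightarrow>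
          (\<forall>j\<in>{1..k}. entry \<pi> j \<le> k)" if "k \<le> length \<pi>"
      proof -
        (* Position 1 satisfies its bound trivially; the others come from \<pi>. *)
        have "{1..Suc k} = insert 1 (Suc ` {1..k})"
          by (auto simp: image_Suc_atLeastAtMost)
        then show ?thesis
          using that by (simp only:) (simp add: entry_Cons_1 entry_Cons_Suc entry_map
              del: image_Suc_atLeastAtMost)
      qed
      then show ?thesis
        using 3 by auto
    qed
  qed
  then have "?C (1 # map Suc \<pi>) = insert 1 (Suc ` ?C \<pi>)"
    by blast
  then show ?thesis
    by (simp add: num_comp_def card_image card_insert_if image_iff)
qed

text \<open>
  No proper prefix can be closed under the permutation when its first entry is the largest value.
\<close>

lemma num_comp_Cons_max:
  assumes "set \<pi> = {1..n}" and "length \<pi> = n"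
  shows "num_comp (Suc n # \<pi>) = 1"
proof -
  have "{i \<in> {1..length (Suc n # \<pi>)}. \<forall>j\<in>{1..i}. entry (Suc n # \<pi>) j \<le> i} = {Suc n}"
  proof (intro equalityI subsetI)
    fix i assume i: "i \<in> {i \<in> {1..length (Suc n # \<pi>)}. \<forall>j\<in>{1..i}. entry (Suc n # \<pi>) j \<le> i}"
    then have "entry (Suc n # \<pi>) 1 \<le> i" by auto
    then show "i \<in> {Suc n}"
      using i assms(2) by (auto simp: entry_Cons_1)
  next
    fix i assume "i \<in> {Suc n}"
    moreover have "entry (Suc n # \<pi>) j \<le> Suc n" if "j \<in> {1..Suc n}" for j
      using entry_in_set[of j "Suc n # \<pi>"] that assms by auto
    ultimately show "i \<in> {i \<in> {1..length (Suc n # \<pi>)}. \<forall>j\<in>{1..i}. entry (Suc n # \<pi>) j \<le> i}"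
      using assms(2) by auto
  qed
  then show ?thesis
    by (simp add: num_comp_def)
qed

lemma statistics_Cons_min:
  assumes "\<pi> \<in> suffix_extremal_perms (Suc n)"
  shows "des (1 # map Suc \<pi>) = des \<pi>"
    and "iar (1 # map Suc \<pi>) = Suc (iar \<pi>)"
    and "num_comp (1 # map Suc \<pi>) = Suc (num_comp \<pi>)"
proof -
  have ne: "\<pi> \<noteq> []"
    using length_suffix_extremal_perm[OF assms] by auto
  then have "hd \<pi> \<ge> 1"
    using hd_in_set[of \<pi>] set_suffix_extremal_perm[OF assms] by auto
  then have lt: "1 < hd (map Suc \<pi>)"
    using ne by (simp add: hd_map)
  have "des (map Suc \<pi>) = des \<pi>" "iar (map Suc \<pi>) = iar \<pi>"
    by (simp_all add: des_def iar_def DES_map_Suc)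
  then show "des (1 # map Suc \<pi>) = des \<pi>" "iar (1 # map Suc \<pi>) = Suc (iar \<pi>)"
    using des_Cons_less[OF _ lt] iar_Cons_less[OF _ lt] ne by simp_all
  show "num_comp (1 # map Suc \<pi>) = Suc (num_comp \<pi>)"
    by (rule num_comp_Cons_min)
qed

lemma statistics_Cons_max:
  assumes "\<pi> \<in> suffix_extremal_perms (Suc n)"
  shows "des (Suc (Suc n) # \<pi>) = Suc (des \<pi>)"
    and "iar (Suc (Suc n) # \<pi>) = 1"
    and "num_comp (Suc (Suc n) # \<pi>) = 1"
proof -
  have ne: "\<pi> \<noteq> []"
    using length_suffix_extremal_perm[OF assms] by auto
  then have gt: "Suc (Suc n) > hd \<pi>"
    using hd_in_set[of \<pi>] set_suffix_extremal_perm[OF assms] by auto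
  show "des (Suc (Suc n) # \<pi>) = Suc (des \<pi>)" "iar (Suc (Suc n) # \<pi>) = 1"
    using ne gt by (rule des_Cons_greater, rule iar_Cons_greater)
  show "num_comp (Suc (Suc n) # \<pi>) = 1"
    by (rule num_comp_Cons_max[OF set_suffix_extremal_perm[OF assms] length_suffix_extremal_perm[OF assms]])
qed

section \<open>Recurrences and generating functions\<close>

unbundle fps_syntax

lemma suffix_extremal_perms_1: "suffix_extremal_perms (Suc 0) = {[1]}"
  by (simp add: suffix_extremal_perms_Suc suffix_extremal_perms_0)

lemma statistics_Nil: "des [] = 0" "iar [] = 0" "num_comp [] = 0"
  by (auto simp: des_def iar_def DES_def num_comp_def card_eq_0_iff)

lemma statistics_singleton: "des [1] = 0" "iar [1] = 1" "num_comp [1] = 1"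
proof -
  show "des [1] = 0" "iar [1] = 1"
    by (simp_all add: des_def iar_def DES_def)
  show "num_comp [1] = 1"
    using num_comp_Cons_max[of "[]" 0] by simp
qed

lemma sum_power_des_suffix_extremal_perms:
  fixes t :: "'a :: comm_ring_1"
  shows "(\<Sum>\<pi>\<in>suffix_extremal_perms (Suc n). t ^ des \<pi>) = (1 + t) ^ n"
proof (induction n)
  case 0
  show ?case
    by (simp add: suffix_extremal_perms_1 statistics_singleton[simplified])
next
  case (Suc n)
  have "(\<Sum>\<pi>\<in>suffix_extremal_perms (Suc (Suc n)). t ^ des \<pi>) =
      (\<Sum>\<pi>\<in>suffix_extremal_perms (Suc n). t ^ des \<pi>) +
      (\<Sum>\<pi>\<in>suffix_extremal_perms (Suc n). t * t ^ des \<pi>)"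
    unfolding sum_suffix_extremal_perms_Suc_Suc
    by (intro arg_cong2[of _ _ _ _ "(+)"] sum.cong refl)
      (simp_all only: statistics_Cons_min statistics_Cons_max power_Suc)
  also have "\<dots> = (1 + t) ^ Suc n"
    by (simp only: sum_distrib_left[symmetric] Suc) (simp add: algebra_simps)
  finally show ?case .
qed

lemma avoid_gf_213_231_nth_0: "avoid_gf {[2, 1, 3], [2, 3, 1]} t r p $ 0 = 1"
  unfolding avoid_gf_def avoiders_213_231_eq
  by (simp add: suffix_extremal_perms_0 statistics_Nil)

lemma avoid_gf_213_231_nth_1: "avoid_gf {[2, 1, 3], [2, 3, 1]} t r p $ Suc 0 = r * p"
  unfolding avoid_gf_def avoiders_213_231_eq
  by (simp add: suffix_extremal_perms_1 statistics_singleton[simplified])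

lemma avoid_gf_213_231_nth_Suc_Suc:
  "avoid_gf {[2, 1, 3], [2, 3, 1]} t r p $ Suc (Suc n) =
     r * p * avoid_gf {[2, 1, 3], [2, 3, 1]} t r p $ Suc n + r * p * t * (1 + t) ^ n"
proof -
  let ?A = "suffix_extremal_perms (Suc n)"
  let ?w = "\<lambda>\<pi>. t ^ des \<pi> * r ^ iar \<pi> * p ^ num_comp \<pi>"
  have "(\<Sum>\<pi>\<in>suffix_extremal_perms (Suc (Suc n)). ?w \<pi>) =
      (\<Sum>\<pi>\<in>?A. r * p * ?w \<pi>) + (\<Sum>\<pi>\<in>?A. r * p * t * t ^ des \<pi>)"
    unfolding sum_suffix_extremal_perms_Suc_Suc
    by (intro arg_cong2[of _ _ _ _ "(+)"] sum.cong refl)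
      (simp_all only: statistics_Cons_min statistics_Cons_max power_Suc power_one_right mult_ac)
  also have "\<dots> = r * p * (\<Sum>\<pi>\<in>?A. ?w \<pi>) + r * p * t * (1 + t) ^ n"
    by (simp only: sum_distrib_left[symmetric] sum_power_des_suffix_extremal_perms)
  finally show ?thesis
    unfolding avoid_gf_def avoiders_213_231_eq by simp
qed

text \<open>
  Over a commutative ring the quotient formula becomes an identity without denominators;
  multiplying by \<open>1 - z - t z\<close> turns the geometric series of \<open>(1 + t) z\<close>, which the
  recurrence contributes, into 1.
\<close>

lemma avoid_gf_213_231_cross_multiplied:
  fixes t r p :: "'a :: comm_ring_1"
  shows "(avoid_gf {[2, 1, 3], [2, 3, 1]} t r p - 1) *
      ((1 - fps_const r * fps_const p * fps_X) * (1 - fps_X - fps_const t * fps_X)) =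
    fps_const r * fps_const p * fps_X * (1 - fps_X)"
proof -
  define F where "F = avoid_gf {[2, 1, 3], [2, 3, 1]} t r p - 1"
  define G where "G = Abs_fps (\<lambda>n. (1 + t) ^ n)"
  have F_nth: "F $ 0 = 0" "F $ Suc 0 = r * p"
      "F $ Suc (Suc n) = r * p * F $ Suc n + r * p * t * (1 + t) ^ n" for n
    unfolding F_def fps_sub_nth avoid_gf_213_231_nth_0 avoid_gf_213_231_nth_1
      avoid_gf_213_231_nth_Suc_Suc
    by simp_all
  have F: "F = fps_const (r * p) * (fps_X * F) +
      fps_const (r * p) * (fps_X * (1 + fps_const t * (fps_X * G)))"
  proof (rule fps_ext)
    fix n
    consider "n = 0" | "n = Suc 0" | m where "n = Suc (Suc m)"
      by (metis not0_implies_Suc)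
    then show "F $ n = (fps_const (r * p) * (fps_X * F)
        + fps_const (r * p) * (fps_X * (1 + fps_const t * (fps_X * G)))) $ n"
      by cases (simp_all add: F_nth G_def mult.assoc)
  qed
  have G: "G = 1 + fps_const (1 + t) * (fps_X * G)"
  proof (rule fps_ext)
    fix n
    show "G $ n = (1 + fps_const (1 + t) * (fps_X * G)) $ n"
      by (cases n) (simp_all add: G_def)
  qed
  let ?D = "1 - fps_X - fps_const t * fps_X"
  have G': "G * ?D = 1"
    using G by (simp add: algebra_simps flip: fps_const_add)
  have F': "F * (1 - fps_const r * fps_const p * fps_X) =
      fps_const r * fps_const p * fps_X * (1 + fps_const t * fps_X * G)"
    using F by (simp add: algebra_simps flip: fps_const_mult)
  have "F * ((1 - fps_const r * fps_const p * fps_X) * ?D) =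
      fps_const r * fps_const p * fps_X * (?D + fps_const t * fps_X * (G * ?D))"
    unfolding mult.assoc[symmetric] F' by (simp only: distrib_left distrib_right mult_1_left mult.assoc)
  also have "?D + fps_const t * fps_X * (G * ?D) = 1 - fps_X"
    unfolding G' by simp
  finally show ?thesis
    unfolding F_def .
qed

theorem theorem4p3:
  fixes t r p :: "'a :: field"
  assumes "r \<noteq> 0" and "p \<noteq> 0"
  shows "avoid_gf_tilde {[2, 1, 3], [2, 3, 1]} t r p =
    (1 - fps_X) /
      ((1 - fps_const r * fps_const p * fps_X) * (1 - fps_X - fps_const t * fps_X))"
proof -
  let ?D = "(1 - fps_const r * fps_const p * fps_X) * (1 - fps_X - fps_const t * fps_X)"
  let ?M = "fps_const r * fps_const p * fps_X"
  let ?F = "avoid_gf {[2, 1, 3], [2, 3, 1]} t r p - 1"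
  have D0: "?D $ 0 = 1"
    by simp
  have M: "?M \<noteq> 0"
    using assms by simp
  have "?F = ?F * (?D * inverse ?D)"
    using D0 by (simp only: inverse_mult_eq_1' one_neq_zero not_False_eq_True mult_1_right)
  also have "\<dots> = ?M * ((1 - fps_X) * inverse ?D)"
    by (simp only: mult.assoc[symmetric] avoid_gf_213_231_cross_multiplied[unfolded mult.assoc[symmetric]])
  finally have "?F / ?M = (1 - fps_X) * inverse ?D"
    using M by (simp only: nonzero_mult_div_cancel_left not_False_eq_True)
  also have "\<dots> = (1 - fps_X) / ?D"
    by (rule fps_divide_unit[symmetric]) (simp only: D0, simp)
  finally show ?thesis
    unfolding avoid_gf_tilde_def .
qed

end
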